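(* Let $n$ be odd, and let $\mathcal{A}$ be a quasi-truncated Hankel tensor of order $m$ and dimension $n$ with generating vector $\mathbf{v} = (v_0, v_1, 0, \ldots, 0, v_{\frac{(n-1)m}{2}}, 0, \ldots, 0, v_{(n-1)m-1}, v_{(n-1)m})^\top$. Suppose that $v_{(i-1)m} \ge 0$ for all $i \in \{1,\ldots,n\}$ and that $m$ is even. If $v_{\frac{(n-1)m}{2}} = 0$, then the quasi-truncated Hankel tensor $\mathcal{A}$ is PSD if and only if $v_1 = v_{(n-1)m-1} = 0$; in this case, $\mathcal{A}$ is a strong Hankel tensor and an SOS Hankel tensor. If $v_{\frac{(n-1)m}{2}} > 0$, then $\mathcal{A}$ is not a strong Hankel tensor.
   Context: A Hankel tensor of order $m$ and dimension $n$ with generating vector $\mathbf{v}=(v_0,\ldots,v_{(n-1)m})^\top$ is the real symmetric tensor $\mathcal{A}=(a_{i_1\cdots i_m})$ with $a_{i_1\cdots i_m}=v_{i_1+\cdots+i_m-m}$ for $i_1,\ldots,i_m\in\{1,\ldots,n\}$. It is called a quasi-truncated Hankel tensor if $n$ is odd and all entries of $\mathbf{v}$ other than $v_0$, $v_1$, $v_{\frac{(n-1)m}{2}}$, $v_{(n-1)m-1}$, $v_{(n-1)m}$ are zero. Since $(n-1)m$ is even, the associated Hankel matrix is the $\frac{(n-1)m+2}{2}\times\frac{(n-1)m+2}{2}$ matrix $A=(a_{ij})$ with $a_{ij}=v_{i+j-2}$; $\mathcal{A}$ is called a strong Hankel tensor if $A$ is positive semi-definite. Let $f(\mathbf{x})=\sum_{i_1,\ldots,i_m=1}^n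 a_{i_1\cdots i_m}x_{i_1}\cdots x_{i_m}$. The tensor $\mathcal{A}$ is PSD (positive semi-definite) if $f(\mathbf{x})\ge 0$ for all $\mathbf{x}\in\mathbb{R}^n$, and, with $m=2k$, it is SOS (sum-of-squares) if $f$ is a finite sum of squares of real homogeneous polynomials of degree $k$.
   Formalization: Assumes n ≥ 3 and m ≥ 2 so that v_1 and v_{(n-1)m-1} exist; the last claim (not strong when the middle entry is positive) excludes m = 2, n = 3, where it is false: v = (1,0,1,0,1) has a positive semi-definite Hankel matrix. *)

theory Defs
  imports "Jordan_Normal_Form.Matrix" "HOL-Library.FuncSet"
begin

text \<open>
  Indices of tensors, vectors and matrices start at 0, as in the matrix library; each index is the
  usual 1-based one minus one. An order \<open>m\<close> tensor of dimension \<open>n\<close> is a real function on the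
  multi-indices \<open>{..<m} \<rightarrow>\<^sub>E {..<n}\<close>; its values elsewhere are irrelevant.
\<close>

type_synonym tensor = "(nat \<Rightarrow> nat) \<Rightarrow> real"

definition tensor_form :: "nat \<Rightarrow> nat \<Rightarrow> tensor \<Rightarrow> real vec \<Rightarrow> real" where
  "tensor_form m n A x = (\<Sum>i \<in> {..<m} \<rightarrow>\<^sub>E {..<n}. A i * (\<Prod>k<m. x $ i k))"

definition psd_tensor :: "nat \<Rightarrow> nat \<Rightarrow> tensor \<Rightarrow> bool" where
  "psd_tensor m n A \<longleftrightarrow> (\<forall>x \<in> carrier_vec n. tensor_form m n A x \<ge> 0)"

text \<open>
  Real homogeneous polynomials of degree \<open>k\<close> in \<open>n\<close> variables, as functions on \<open>carrier_vec n\<close>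
  (over the reals, polynomials and polynomial functions correspond). The bound \<open>{..k}\<close> on the
  exponents is implied by the degree condition and only makes the index set visibly finite.
\<close>

definition homogeneous_polynomial :: "nat \<Rightarrow> nat \<Rightarrow> (real vec \<Rightarrow> real) \<Rightarrow> bool" where
  "homogeneous_polynomial n k g \<longleftrightarrow>
     (\<exists>c :: (nat \<Rightarrow> nat) \<Rightarrow> real. \<forall>x \<in> carrier_vec n.
        g x = (\<Sum>\<alpha> \<in> {\<alpha> \<in> {..<n} \<rightarrow>\<^sub>E {..k}. (\<Sum>j<n. \<alpha> j) = k}. c \<alpha> * (\<Prod>j<n. (x $ j) ^ \<alpha> j)))"

definition sos_tensor :: "nat \<Rightarrow> nat \<Rightarrow> tensor \<Rightarrow> bool" where
  "sos_tensor m n A \<longleftrightarrow>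
     (\<exists>k. m = 2 * k \<and>
       (\<exists>(r :: nat) g. (\<forall>l<r. homogeneous_polynomial n k (g l)) \<and>
          (\<forall>x \<in> carrier_vec n. tensor_form m n A x = (\<Sum>l<r. (g l x)\<^sup>2))))"

text \<open>
  With 0-based indices, \<open>v\<^bsub>i\<^sub>1 + \<dots> + i\<^sub>m - m\<^esub>\<close> becomes the entry of \<open>v\<close> at the plain index sum, and
  \<open>v\<^bsub>i + j - 2\<^esub>\<close> the entry at \<open>i + j\<close>. The generating vector of a Hankel tensor of order \<open>m\<close> and
  dimension \<open>n\<close> is an element of \<open>carrier_vec ((n - 1) * m + 1)\<close>.
\<close>

definition hankel_tensor :: "nat \<Rightarrow> real vec \<Rightarrow> tensor" where
  "hankel_tensor m v = (\<lambda>i. v $ (\<Sum>k<m. i k))"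

definition quasi_truncated_hankel :: "nat \<Rightarrow> nat \<Rightarrow> real vec \<Rightarrow> bool" where
  "quasi_truncated_hankel m n v \<longleftrightarrow>
     odd n \<and> v \<in> carrier_vec ((n - 1) * m + 1) \<and>
     (\<forall>j \<le> (n - 1) * m.
        j \<notin> {0, 1, (n - 1) * m div 2, (n - 1) * m - 1, (n - 1) * m} \<longrightarrow> v $ j = 0)"

definition associated_hankel_matrix :: "nat \<Rightarrow> nat \<Rightarrow> real vec \<Rightarrow> real mat" where
  "associated_hankel_matrix m n v =
     (let d = ((n - 1) * m + 2) div 2 in mat d d (\<lambda>(i, j). v $ (i + j)))"

definition psd_matrix :: "real mat \<Rightarrow> bool" where
  "psd_matrix M \<longleftrightarrow>
     square_mat M \<and> transpose_mat M = M \<and>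
     (\<forall>x \<in> carrier_vec (dim_row M). x \<bullet> (M *\<^sub>v x) \<ge> 0)"

text \<open>The generating vector is determined by the tensor, so this is a property of the tensor.\<close>

definition strong_hankel :: "nat \<Rightarrow> nat \<Rightarrow> real vec \<Rightarrow> bool" where
  "strong_hankel m n v \<longleftrightarrow> psd_matrix (associated_hankel_matrix m n v)"

end

theory Submission
  imports Defs "HOL-Computational_Algebra.Polynomial"
begin

text \<open>
  Write \<open>L = (n - 1) * m\<close>. An entry of a Hankel tensor depends on its multi-index \<open>i\<close> only through
  the sum of \<open>i\<close>, so grouping the monomials of the form by this sum gives
  \<open>f(x) = \<Sum>s\<le>L. v\<^sub>s c\<^sub>s(x)\<close>, where \<open>c\<^sub>s(x)\<close> is the coefficient of \<open>T\<^sup>s\<close> in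
  \<open>(\<Sum>j<n. x\<^sub>j T\<^sup>j)\<^sup>m\<close> (\<open>tensor_form_hankel\<close>). The two lowest coefficients are \<open>x\<^sub>0\<^sup>m\<close> and
  \<open>m x\<^sub>0\<^bsup>m-1\<^esup> x\<^sub>1\<close>, and reversing the order of the coordinates gives the two highest ones. If the
  middle entry of \<open>v\<close> vanishes, these four terms are the whole form
  (\<open>tensor_form_quasi_truncated_hankel\<close>).

  For vanishing middle entry the form is affine in \<open>t\<close> at the point \<open>e\<^sub>0 + t e\<^sub>1\<close>, with slope \<open>m v\<^sub>1\<close>,
  so nonnegativity forces \<open>v\<^sub>1 = 0\<close>; the other end is alike. Conversely, when both entries are zero,
  only \<open>v\<^sub>0 x\<^sub>0\<^sup>m + v\<^sub>L x\<^sub>n\<^sub>-\<^sub>1\<^sup>m\<close> is left. It is visibly a sum of two squares because \<open>m\<close> is even, and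
  the Hankel matrix is diagonal with the nonnegative entries \<open>v\<^sub>0\<close>, \<open>v\<^sub>L\<close> in its corners.

  For positive middle entry \<open>v\<^sub>h\<close>, \<open>h = L / 2\<close>, exclude \<open>L = 4\<close>, which only \<open>m = 2\<close>, \<open>n = 3\<close> attains.
  Then \<open>1 < h - 1\<close>, and the principal submatrix of the Hankel matrix on the rows \<open>1\<close> and \<open>h - 1\<close> has
  the diagonal entries \<open>v\<^sub>2 = v\<^sub>L\<^sub>-\<^sub>2 = 0\<close> and the off-diagonal entry \<open>v\<^sub>h\<close>, so it is indefinite.
\<close>

section \<open>The form of a Hankel tensor\<close>

definition coordinate_poly :: "nat \<Rightarrow> real vec \<Rightarrow> real poly" where
  "coordinate_poly n x = (\<Sum>j<n. monom (x $ j) j)"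

lemma prod_monom:
  "finite K \<Longrightarrow> (\<Prod>k\<in>K. monom (a k :: 'a::comm_semiring_1) (e k)) = monom (prod a K) (sum e K)"
  by (induction K rule: finite_induct) (auto simp: mult_monom one_pCons monom_0)

text \<open>
  Expanding the product of \<open>m\<close> copies of the coordinate polynomial chooses one exponent \<open>i k < n\<close> in
  each factor, so the terms are indexed exactly by the multi-indices of the tensor.
\<close>

lemma coordinate_poly_power:
  "coordinate_poly n x ^ m =
     (\<Sum>i \<in> {..<m} \<rightarrow>\<^sub>E {..<n}. monom (\<Prod>k<m. x $ i k) (\<Sum>k<m. i k))"
proof -
  have "coordinate_poly n x ^ m = (\<Prod>k<m. \<Sum>j<n. monom (x $ j) j)"
    by (simp add: coordinate_poly_def)
  also have "\<dots> = (\<Sum>i \<in> {..<m} \<rightarrow>\<^sub>E {..<n}. \<Prod>k<m. monom (x $ i k) (i k))"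
    by (subst prod_sum_PiE) auto
  also have "\<dots> = (\<Sum>i \<in> {..<m} \<rightarrow>\<^sub>E {..<n}. monom (\<Prod>k<m. x $ i k) (\<Sum>k<m. i k))"
    by (simp add: prod_monom)
  finally show ?thesis .
qed

lemma coeff_coordinate_poly_power:
  "coeff (coordinate_poly n x ^ m) s =
     (\<Sum>i \<in> {..<m} \<rightarrow>\<^sub>E {..<n}. if (\<Sum>k<m. i k) = s then \<Prod>k<m. x $ i k else 0)"
  by (simp add: coordinate_poly_power coeff_sum)

lemma index_sum_le:
  fixes m n :: nat
  assumes "i \<in> {..<m} \<rightarrow>\<^sub>E {..<n}"
  shows "(\<Sum>k<m. i k) \<le> (n - 1) * m"
proof -
  have "i k \<le> n - 1" if "k < m" for k
    using PiE_mem[OF assms, of k] that by auto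
  then have "(\<Sum>k<m. i k) \<le> (\<Sum>k<m. n - 1)"
    by (intro sum_mono) auto
  then show ?thesis by (simp add: mult.commute)
qed

lemma tensor_form_hankel:
  "tensor_form m n (hankel_tensor m v) x =
     (\<Sum>s \<le> (n - 1) * m. v $ s * coeff (coordinate_poly n x ^ m) s)"
proof -
  have "(\<Sum>s \<le> (n - 1) * m. v $ s * coeff (coordinate_poly n x ^ m) s) =
      (\<Sum>i \<in> {..<m} \<rightarrow>\<^sub>E {..<n}. \<Sum>s \<le> (n - 1) * m.
         if (\<Sum>k<m. i k) = s then v $ s * (\<Prod>k<m. x $ i k) else 0)"
    unfolding coeff_coordinate_poly_power sum_distrib_left
    by (subst sum.swap) (intro sum.cong refl, simp)
  also have "\<dots> = (\<Sum>i \<in> {..<m} \<rightarrow>\<^sub>E {..<n}. v $ (\<Sum>k<m. i k) * (\<Prod>k<m. x $ i k))"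
    using index_sum_le[of _ m n] by (intro sum.cong refl) simp
  finally show ?thesis
    by (simp add: tensor_form_def hankel_tensor_def)
qed

lemma coeff_power_1:
  fixes p :: "'a::comm_semiring_1 poly"
  shows "coeff (p ^ m) 1 = of_nat m * coeff p 0 ^ (m - 1) * coeff p 1"
proof (induction m)
  case (Suc m)
  have "coeff (p ^ Suc m) 1 = coeff p 0 * coeff (p ^ m) 1 + coeff p 1 * coeff p 0 ^ m"
    by (simp add: coeff_mult coeff_0_power)
  also have "coeff p 0 * coeff (p ^ m) 1 = of_nat m * coeff p 0 ^ m * coeff p 1"
    unfolding Suc by (cases m) (auto simp: algebra_simps)
  finally show ?case by (simp add: algebra_simps)
qed simp

lemma coeff_coordinate_poly:
  "coeff (coordinate_poly n x) s = (if s < n then x $ s else 0)"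
  by (simp add: coordinate_poly_def coeff_sum)

text \<open>
  The involution \<open>i \<mapsto> n - 1 - i\<close> on multi-indices replaces the index sum \<open>s\<close> by \<open>(n - 1) * m - s\<close>. This
  transfers what is known about the lowest coefficients to the highest ones, without a case distinction
  on the degree of the polynomial, which drops when the last coordinate of \<open>x\<close> is zero.
\<close>

lemma coeff_coordinate_poly_power_reverse:
  assumes "s \<le> (n - 1) * m"
  shows "coeff (coordinate_poly n x ^ m) ((n - 1) * m - s) =
         coeff (coordinate_poly n (vec n (\<lambda>j. x $ (n - 1 - j))) ^ m) s"
proof -
  define R where "R = (\<lambda>i :: nat \<Rightarrow> nat. \<lambda>k\<in>{..<m}. n - 1 - i k)"
  let ?I = "{..<m} \<rightarrow>\<^sub>E {..<n}"
  have R: "R i \<in> ?I" "R (R i) = i" "(\<Sum>k<m. R i k) = (n - 1) * m - (\<Sum>k<m. i k)"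
    if i: "i \<in> ?I" for i
  proof -
    have lt: "i k < n" if "k < m" for k
      using PiE_mem[OF i, of k] that by simp
    show "R i \<in> ?I"
      unfolding R_def by (rule restrict_PiE_iff[THEN iffD2]) (use lt in fastforce)
    show "R (R i) = i"
    proof
      fix k show "R (R i) k = i k"
        using lt[of k] PiE_arb[OF i, of k] by (cases "k < m") (auto simp: R_def)
    qed
    have "(\<Sum>k<m. R i k) = (\<Sum>k<m. n - 1 - i k)"
      by (simp add: R_def)
    also have "\<dots> = (\<Sum>k<m. n - 1) - (\<Sum>k<m. i k)"
      using lt by (intro sum_subtractf_nat) fastforce
    finally show "(\<Sum>k<m. R i k) = (n - 1) * m - (\<Sum>k<m. i k)"
      by (simp add: mult.commute)
  qed
  show ?thesis
    unfolding coeff_coordinate_poly_power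
  proof (rule sum.reindex_bij_witness[of _ R R], goal_cases)
    case (5 i)
    have "(\<Sum>k<m. i k) = (n - 1) * m - s \<longleftrightarrow> (\<Sum>k<m. R i k) = s"
      using R(3)[OF 5] index_sum_le[OF 5] assms by linarith
    moreover have "(\<Prod>k<m. vec n (\<lambda>j. x $ (n - 1 - j)) $ R i k) = (\<Prod>k<m. x $ i k)"
    proof (intro prod.cong refl)
      fix k assume "k \<in> {..<m}"
      then have "i k < n" using 5 by auto
      then show "vec n (\<lambda>j. x $ (n - 1 - j)) $ R i k = x $ i k"
        using \<open>k \<in> {..<m}\<close> by (simp add: R_def)
    qed
    ultimately show ?case by simp
  qed (auto simp: R)
qed

lemma tensor_form_quasi_truncated_hankel:
  assumes "n \<ge> 3" "m \<ge> 2" "quasi_truncated_hankel m n v" "v $ ((n - 1) * m div 2) = 0"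
  shows "tensor_form m n (hankel_tensor m v) x =
     v $ 0 * (x $ 0) ^ m + v $ 1 * (real m * (x $ 0) ^ (m - 1) * x $ 1) +
     v $ ((n - 1) * m - 1) * (real m * (x $ (n - 1)) ^ (m - 1) * x $ (n - 2)) +
     v $ ((n - 1) * m) * (x $ (n - 1)) ^ m"
proof -
  define L where "L = (n - 1) * m"
  define c where "c = coeff (coordinate_poly n x ^ m)"
  have "2 * 2 \<le> L"
    unfolding L_def using assms by (intro mult_mono) auto
  then have L: "L \<ge> 4" by simp
  have c: "c 0 = (x $ 0) ^ m" "c 1 = real m * (x $ 0) ^ (m - 1) * x $ 1"
    using assms by (simp_all add: c_def coeff_0_power coeff_power_1[unfolded One_nat_def] coeff_coordinate_poly)
  have rev: "c (L - s) = coeff (coordinate_poly n (vec n (\<lambda>j. x $ (n - 1 - j))) ^ m) s"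
    if "s \<le> L" for s
    using coeff_coordinate_poly_power_reverse that unfolding c_def L_def .
  have L1: "1 \<le> L" using L by simp
  have cL: "c L = (x $ (n - 1)) ^ m"
       "c (L - 1) = real m * (x $ (n - 1)) ^ (m - 1) * x $ (n - 2)"
    using rev[of 0] rev[of 1, OF L1] assms L
    by (simp_all add: coeff_0_power coeff_power_1[unfolded One_nat_def] coeff_coordinate_poly numeral_2_eq_2)
  have "(\<Sum>s\<le>L. v $ s * c s) = (\<Sum>s\<in>{0, 1, L - 1, L}. v $ s * c s)"
  proof (rule sum.mono_neutral_right)
    show "\<forall>s\<in>{..L} - {0, 1, L - 1, L}. v $ s * c s = 0"
      using assms(3,4) by (auto simp: quasi_truncated_hankel_def L_def)
  qed (use L in auto)
  also have "\<dots> = v $ 0 * c 0 + v $ 1 * c 1 + v $ (L - 1) * c (L - 1) + v $ L * c L"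
    using L by simp
  finally show ?thesis
    unfolding tensor_form_hankel c_def[symmetric] L_def[symmetric] c cL .
qed

section \<open>Positivity and sums of squares\<close>

lemma affine_nonneg_imp_slope_zero:
  fixes a b :: real
  assumes "\<And>t. a + b * t \<ge> 0"
  shows "b = 0"
proof (rule ccontr)
  assume "b \<noteq> 0"
  with assms[of "- (a + 1) / b"] show False by simp
qed

text \<open>The coefficient family is supported on the single exponent vector \<open>k e\<^sub>j\<close>.\<close>

lemma homogeneous_polynomial_scaled_power:
  assumes "j < n"
  shows "homogeneous_polynomial n k (\<lambda>x. c * (x $ j) ^ k)"
proof -
  define e where "e = (\<lambda>l\<in>{..<n}. if l = j then k else 0)"
  let ?E = "{\<alpha> \<in> {..<n} \<rightarrow>\<^sub>E {..k}. (\<Sum>j<n. \<alpha> j) = k}"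
  have "e \<in> ?E"
    using assms by (auto simp: e_def)
  moreover have "finite ?E"
    by (rule finite_subset[of _ "{..<n} \<rightarrow>\<^sub>E {..k}"]) (auto intro: finite_PiE)
  moreover have "(\<Prod>l<n. (x $ l) ^ e l) = (x $ j) ^ k" for x :: "real vec"
  proof -
    have "(\<Prod>l<n. (x $ l) ^ e l) = (\<Prod>l<n. if l = j then (x $ j) ^ k else 1)"
      by (intro prod.cong) (auto simp: e_def)
    then show ?thesis using assms by simp
  qed
  ultimately show ?thesis
    unfolding homogeneous_polynomial_def
    by (intro exI[of _ "\<lambda>\<alpha>. if \<alpha> = e then c else 0"])
       (simp add: if_distrib[of "\<lambda>z. z * _"] cong: if_cong)
qed

section \<open>The associated Hankel matrix\<close>

lemma associated_hankel_matrix_quadratic_form: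
  assumes "x \<in> carrier_vec ((n - 1) * m div 2 + 1)"
  shows "x \<bullet> (associated_hankel_matrix m n v *\<^sub>v x) =
     (\<Sum>i \<le> (n - 1) * m div 2. \<Sum>j \<le> (n - 1) * m div 2. v $ (i + j) * x $ i * x $ j)"
proof -
  let ?h = "(n - 1) * m div 2"
  have "x \<bullet> (associated_hankel_matrix m n v *\<^sub>v x) =
      (\<Sum>i < Suc ?h. x $ i * (\<Sum>j < Suc ?h. v $ (i + j) * x $ j))"
    using assms
    by (simp add: associated_hankel_matrix_def scalar_prod_def lessThan_atLeast0 Let_def)
  then show ?thesis
    by (simp add: lessThan_Suc_atMost sum_distrib_left algebra_simps)
qed

lemma strong_hankel_iff:
  "strong_hankel m n v \<longleftrightarrow>
     (\<forall>x \<in> carrier_vec ((n - 1) * m div 2 + 1).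
        0 \<le> (\<Sum>i \<le> (n - 1) * m div 2. \<Sum>j \<le> (n - 1) * m div 2. v $ (i + j) * x $ i * x $ j))"
proof -
  have "square_mat (associated_hankel_matrix m n v)"
       "transpose_mat (associated_hankel_matrix m n v) = associated_hankel_matrix m n v"
       "dim_row (associated_hankel_matrix m n v) = (n - 1) * m div 2 + 1"
    by (auto simp: associated_hankel_matrix_def Let_def add.commute)
  then show ?thesis
    using associated_hankel_matrix_quadratic_form
    by (simp add: strong_hankel_def psd_matrix_def)
qed

section \<open>Quasi-truncated Hankel tensors\<close>

theorem proposition2:
  fixes m n :: nat and v :: "real vec"
  assumes "odd n" and "n \<ge> 3"
    and "even m" and "m \<ge> 2"
    and "quasi_truncated_hankel m n v"
    and "\<forall>i \<in> {1..n}. v $ ((i - 1) * m) \<ge> 0"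
  shows "(v $ ((n - 1) * m div 2) = 0 \<longrightarrow>
            (psd_tensor m n (hankel_tensor m v) \<longleftrightarrow> v $ 1 = 0 \<and> v $ ((n - 1) * m - 1) = 0) \<and>
            (psd_tensor m n (hankel_tensor m v) \<longrightarrow>
               strong_hankel m n v \<and> sos_tensor m n (hankel_tensor m v))) \<and>
         (v $ ((n - 1) * m div 2) > 0 \<and> \<not> (m = 2 \<and> n = 3) \<longrightarrow> \<not> strong_hankel m n v)"
proof -
  define L where "L = (n - 1) * m"
  define h where "h = L div 2"
  have "even L" using assms(3) by (simp add: L_def)
  then have Lh: "L = 2 * h" by (simp add: h_def)
  have "2 * 2 \<le> L"
    unfolding L_def using assms(2,4) by (intro mult_mono) auto
  with Lh have h2: "h \<ge> 2" by simp
  have zero: "v $ j = 0" if "j \<le> L" "j \<notin> {0, 1, h, L - 1, L}" for j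
    using assms(5) that by (auto simp: quasi_truncated_hankel_def L_def h_def)
  have v0: "v $ 0 \<ge> 0"
    using assms(2,6) by (auto dest: bspec[of _ _ 1])
  have vL: "v $ L \<ge> 0"
    using assms(2,6) by (auto simp: L_def dest: bspec[of _ _ n])
  note strong = strong_hankel_iff[of m n v, folded L_def, folded h_def]

  have "(psd_tensor m n (hankel_tensor m v) \<longleftrightarrow> v $ 1 = 0 \<and> v $ (L - 1) = 0) \<and>
        (psd_tensor m n (hankel_tensor m v) \<longrightarrow>
           strong_hankel m n v \<and> sos_tensor m n (hankel_tensor m v))"
    if vh: "v $ h = 0"
  proof -
    note form = tensor_form_quasi_truncated_hankel[OF assms(2,4,5), folded L_def, folded h_def, OF vh]
    have ends: "v $ 1 = 0 \<and> v $ (L - 1) = 0" if psd: "psd_tensor m n (hankel_tensor m v)"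
    proof
      have nonneg: "tensor_form m n (hankel_tensor m v) (vec n f) \<ge> 0" for f
        using psd by (simp add: psd_tensor_def)
      have neq: "n - Suc 0 \<noteq> Suc 0" "m - Suc 0 \<noteq> 0" using assms(2,4) by simp_all
      have "v $ 0 + v $ 1 * real m * t \<ge> 0" for t
        using nonneg[of "\<lambda>j. if j = 0 then 1 else if j = 1 then t else 0"] assms(2,4) neq
        by (simp add: form power_0_left mult.assoc)
      then have "v $ 1 * real m = 0" by (rule affine_nonneg_imp_slope_zero)
      then show "v $ 1 = 0" using assms(4) by simp
      have neq': "n - 2 \<noteq> n - Suc 0" using assms(2) by simp
      have "v $ L + v $ (L - 1) * real m * t \<ge> 0" for t
        using nonneg[of "\<lambda>j. if j = n - 1 then 1 else if j = n - 2 then t else 0"] assms(2,4) neq'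
        by (simp add: form power_0_left mult.assoc add.commute)
      then have "v $ (L - 1) * real m = 0" by (rule affine_nonneg_imp_slope_zero)
      then show "v $ (L - 1) = 0" using assms(4) by simp
    qed
    have rest: "psd_tensor m n (hankel_tensor m v) \<and> strong_hankel m n v \<and>
        sos_tensor m n (hankel_tensor m v)"
      if v1: "v $ 1 = 0" and v1': "v $ (L - 1) = 0"
    proof (intro conjI)
      have form': "tensor_form m n (hankel_tensor m v) x =
          v $ 0 * (x $ 0) ^ m + v $ L * (x $ (n - 1)) ^ m" for x
        unfolding form v1 v1' by simp
      show "psd_tensor m n (hankel_tensor m v)"
        using v0 vL assms(3) by (simp add: psd_tensor_def form' zero_le_even_power)
      show "strong_hankel m n v"
        unfolding strong
      proof
        fix x :: "real vec"
        \<comment> \<open>The sum \<open>i + j\<close> equals \<open>0\<close> or \<open>L = 2 * h\<close> only in the two corners.\<close>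
        have entry: "v $ (i + j) = (if j = 0 then if i = 0 then v $ 0 else 0 else 0) +
                               (if j = h then if i = h then v $ L else 0 else 0)"
          if "i \<le> h" "j \<le> h" for i j
          using that h2 zero[of "i + j"] v1 v1' vh Lh
          by (cases "i + j \<in> {0, 1, h, L - 1, L}") (auto simp flip: mult_2)
        have "(\<Sum>i\<le>h. \<Sum>j\<le>h. v $ (i + j) * x $ i * x $ j) =
              (\<Sum>i\<le>h. \<Sum>j\<le>h. (if j = 0 then if i = 0 then v $ 0 * (x $ 0)\<^sup>2 else 0 else 0) +
                (if j = h then if i = h then v $ L * (x $ h)\<^sup>2 else 0 else 0))"
          using h2 by (intro sum.cong refl) (auto simp: entry power2_eq_square)
        also have "\<dots> = v $ 0 * (x $ 0)\<^sup>2 + v $ L * (x $ h)\<^sup>2"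
          by (simp add: sum.distrib)
        finally show "0 \<le> (\<Sum>i\<le>h. \<Sum>j\<le>h. v $ (i + j) * x $ i * x $ j)"
          using v0 vL by simp
      qed
      obtain k where k: "m = 2 * k" using assms(3) by blast
      define g where "g = (\<lambda>l :: nat. if l = 0 then \<lambda>x. sqrt (v $ 0) * (x $ 0) ^ k
                           else (\<lambda>x :: real vec. sqrt (v $ L) * (x $ (n - 1)) ^ k))"
      have "\<forall>l<2. homogeneous_polynomial n k (g l)"
        using assms(2) by (simp add: g_def homogeneous_polynomial_scaled_power)
      moreover have "tensor_form m n (hankel_tensor m v) x = (\<Sum>l<2. (g l x)\<^sup>2)" for x
      proof -
        have sq: "y ^ m = (y ^ k)\<^sup>2" for y :: real
          by (simp add: k mult.commute flip: power_mult)
        have "(\<Sum>l<2. (g l x)\<^sup>2) = (g 0 x)\<^sup>2 + (g 1 x)\<^sup>2"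
          by (simp add: lessThan_nat_numeral)
        then show ?thesis
          using v0 vL by (simp add: form' sq g_def power_mult_distrib)
      qed
      ultimately show "sos_tensor m n (hankel_tensor m v)"
        unfolding sos_tensor_def using k by blast
    qed
    from ends rest show ?thesis by blast
  qed
  moreover have "\<not> strong_hankel m n v" if vh: "v $ h > 0" and ne: "\<not> (m = 2 \<and> n = 3)"
  proof
    assume s: "strong_hankel m n v"
    \<comment> \<open>For \<open>h = 2\<close> the indices \<open>1\<close> and \<open>h - 1\<close> coincide; this is the case \<open>m = 2\<close>, \<open>n = 3\<close>.\<close>
    have "h \<noteq> 2"
    proof
      assume "h = 2"
      then have "(n - 1) * m = 4" using Lh by (simp add: L_def)
      moreover have "2 * m \<le> (n - 1) * m" "(n - 1) * 2 \<le> (n - 1) * m"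
        using assms(2,4) by (intro mult_mono; simp)+
      ultimately have "m \<le> 2" "n \<le> 3" by linarith+
      with ne assms(2,4) show False by simp
    qed
    with h2 have h3: "h \<ge> 3" and apart: "Suc 0 \<noteq> h - Suc 0" by simp_all
    \<comment> \<open>The vector \<open>e\<^sub>1 - e\<^sub>h\<^sub>-\<^sub>1\<close>: its diagonal contributions \<open>v\<^sub>2\<close> and \<open>v\<^sub>L\<^sub>-\<^sub>2\<close> vanish because \<open>2 < h\<close>, and
      the mixed ones both carry \<open>v\<^sub>h\<close> with a negative sign.\<close>
    define x where "x = vec (h + 1) (\<lambda>i. (if i = 1 then 1 else 0) - (if i = h - 1 then 1 else 0 :: real))"
    have "(\<Sum>i\<le>h. \<Sum>j\<le>h. v $ (i + j) * x $ i * x $ j) =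
          (\<Sum>i\<in>{1, h - 1}. \<Sum>j\<in>{1, h - 1}. v $ (i + j) * x $ i * x $ j)"
      using h3 by (intro sum.mono_neutral_cong_right) (auto simp: x_def intro!: sum.neutral sum.mono_neutral_right)
    also have "\<dots> = v $ 2 - 2 * v $ h + v $ (L - 2)"
      using h3 Lh apart by (simp add: x_def numeral_2_eq_2 algebra_simps)
    also have "\<dots> = - 2 * v $ h"
    proof -
      have "L - 2 \<notin> {0, 1, h, L - 1, L}" "2 \<notin> {0, 1, h, L - 1, L}"
        using h3 Lh by auto
      then show ?thesis
        using zero[of 2] zero[of "L - 2"] h3 Lh by simp
    qed
    finally have negative: "(\<Sum>i\<le>h. \<Sum>j\<le>h. v $ (i + j) * x $ i * x $ j) < 0"
      using vh by simp
    have "x \<in> carrier_vec (h + 1)" by (simp add: x_def)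
    with s have "0 \<le> (\<Sum>i\<le>h. \<Sum>j\<le>h. v $ (i + j) * x $ i * x $ j)"
      unfolding strong by blast
    with negative show False by simp
  qed
  ultimately show ?thesis
    unfolding L_def[symmetric] h_def[symmetric] by blast
qed

end
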